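(* The maximum number of distinct valid answers in a percentage test is $13$.
   Context: A percentage test is a finite nonempty multiset of positive integers (its answers, or options, interpreted as percentages; order is irrelevant). Let $K$ be the number of options counted with multiplicity, and let $m_a$ be the number of times the value $a$ appears. A value $a$ appearing in the test is a valid answer if $a=\frac{100\,m_a}{K}$. *)

theory Defs
  imports Complex_Main "HOL-Library.Multiset"
begin

definition percentage_test :: "nat multiset \<Rightarrow> bool" where
  "percentage_test T \<longleftrightarrow> T \<noteq> {#} \<and> (\<forall>a \<in># T. 0 < a)"

text \<open>The equation is read over the reals, with exact division.\<close>

definition valid_answer :: "nat multiset \<Rightarrow> nat \<Rightarrow> bool" where
  "valid_answer T a \<longleftrightarrow> a \<in># T \<and> real a = 100 * real (count T a) / real (size T)"

text \<open>This is a subset of the finite set \<open>set_mset T\<close>, so its cardinality is meaningful.\<close>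

definition valid_answers :: "nat multiset \<Rightarrow> nat set" where
  "valid_answers T = {a. valid_answer T a}"

end

theory Submission
  imports Defs
begin

text \<open>
  The valid answers of a test always sum to at most 100: if \<open>K\<close> is the number of options
  and \<open>m\<^sub>a\<close> the multiplicity of \<open>a\<close>, clearing denominators shows that a valid answer \<open>a\<close>
  satisfies \<open>a * K = 100 * m\<^sub>a\<close>, and the multiplicities \<open>m\<^sub>a\<close> of distinct values
  add up to at most \<open>K\<close>.  Fourteen distinct positive integers sum to at least
  \<open>1 + \<dots> + 14 = 105\<close>, so there are at most thirteen valid answers.

  Conversely, any set of positive integers with sum exactly 100 is the set of valid answers
  of the test that lists each \<open>a\<close> exactly \<open>a\<close> times, since such a test has 100 options.
  As \<open>1 + \<dots> + 12 + 22 = 100\<close>, thirteen valid answers are possible.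
\<close>

lemma valid_answer_iff:
  assumes "T \<noteq> {#}"
  shows "valid_answer T a \<longleftrightarrow> a \<in># T \<and> a * size T = 100 * count T a"
proof -
  have "real a = 100 * real (count T a) / real (size T) \<longleftrightarrow>
      real (a * size T) = real (100 * count T a)"
    using assms by (simp add: field_simps)
  then show ?thesis
    unfolding valid_answer_def by (simp only: of_nat_eq_iff)
qed

lemma finite_valid_answers: "finite (valid_answers T)"
  by (rule finite_subset[of _ "set_mset T"]) (auto simp: valid_answers_def valid_answer_def)

lemma sum_valid_answers_le:
  assumes "T \<noteq> {#}"
  shows "\<Sum>(valid_answers T) \<le> 100"
proof -
  have "\<Sum>(valid_answers T) * size T = (\<Sum>a\<in>valid_answers T. 100 * count T a)"
    using valid_answer_iff[OF assms] by (simp add: sum_distrib_right valid_answers_def)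
  also have "\<dots> = 100 * sum (count T) (valid_answers T)"
    by (simp add: sum_distrib_left)
  also have "sum (count T) (valid_answers T) \<le> sum (count T) (set_mset T)"
    by (rule sum_mono2) (auto simp: valid_answers_def valid_answer_def)
  also have "sum (count T) (set_mset T) = size T"
    by (simp add: size_multiset_overloaded_eq)
  finally show ?thesis
    using assms by (simp add: nonempty_has_size)
qed

text \<open>
  Adding the elements in increasing order, the \<open>n\<close>-th one is at least \<open>n\<close>, because it and
  its predecessors are \<open>n\<close> distinct elements of the interval from 1 up to it.
\<close>

lemma triangular_card_le_sum:
  fixes A :: "nat set"
  assumes "finite A" and "0 \<notin> A"
  shows "card A * (card A + 1) \<le> 2 * \<Sum>A"
  using assms
proof (induction A rule: finite_linorder_max_induct)
  case empty
  then show ?case by simp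
next
  case (insert b A)
  have "insert b A \<subseteq> {1..b}"
    using insert.hyps insert.prems by (auto simp: Suc_le_eq intro!: gr0I)
  then have "card (insert b A) \<le> b"
    using card_mono[of "{1..b}" "insert b A"] by simp
  moreover have "b \<notin> A"
    using insert.hyps by blast
  ultimately show ?case
    using insert by (simp add: algebra_simps)
qed

definition self_counting_test :: "nat set \<Rightarrow> nat multiset" where
  "self_counting_test S = (\<Sum>a\<in>S. replicate_mset a a)"

lemma count_self_counting_test:
  assumes "finite S"
  shows "count (self_counting_test S) a = (if a \<in> S then a else 0)"
  using assms by (simp add: self_counting_test_def count_sum)

lemma size_self_counting_test: "size (self_counting_test S) = \<Sum>S"
  unfolding self_counting_test_def
  by (induction S rule: infinite_finite_induct) auto

lemma set_self_counting_test:
  assumes "finite S" and "0 \<notin> S"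
  shows "set_mset (self_counting_test S) = S"
  using assms by (auto simp: set_mset_def count_self_counting_test intro: gr0I)

lemma self_counting_test_all_valid:
  assumes "finite S" and "0 \<notin> S" and "\<Sum>S = 100"
  shows "percentage_test (self_counting_test S)"
    and "valid_answers (self_counting_test S) = S"
proof -
  have nonempty: "self_counting_test S \<noteq> {#}"
    using size_self_counting_test[of S] assms(3) by auto
  show "percentage_test (self_counting_test S)"
    using nonempty assms by (auto simp: percentage_test_def set_self_counting_test intro: gr0I)
  show "valid_answers (self_counting_test S) = S"
    using assms by (auto simp: valid_answers_def valid_answer_iff[OF nonempty]
        set_self_counting_test size_self_counting_test count_self_counting_test)
qed

theorem proposition12:
  shows "(\<exists>T. percentage_test T \<and> card (valid_answers T) = 13) \<and>
         (\<forall>T. percentage_test T \<longrightarrow> card (valid_answers T) \<le> 13)"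
proof (intro conjI allI impI)
  define S :: "nat set" where "S = insert 22 {1..12}"
  have "finite S" "0 \<notin> S" "card S = 13"
    by (simp_all add: S_def)
  moreover have "\<Sum>S = 100"
    by (simp add: S_def gauss_sum_nat Sum_Icc_nat)
  ultimately show "\<exists>T. percentage_test T \<and> card (valid_answers T) = 13"
    using self_counting_test_all_valid by metis
next
  fix T assume T: "percentage_test T"
  let ?n = "card (valid_answers T)"
  have "0 \<notin> valid_answers T"
    using T by (auto simp: percentage_test_def valid_answers_def valid_answer_def)
  then have "?n * (?n + 1) \<le> 2 * \<Sum>(valid_answers T)"
    by (intro triangular_card_le_sum finite_valid_answers)
  also have "\<dots> \<le> 200"
    using T sum_valid_answers_le[of T] by (simp add: percentage_test_def)
  finally have bound: "?n * (?n + 1) \<le> 200" .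
  show "?n \<le> 13"
  proof (rule ccontr)
    assume "\<not> ?n \<le> 13"
    then have "14 * 15 \<le> ?n * (?n + 1)"
      by (intro mult_le_mono) auto
    with bound show False by simp
  qed
qed

end
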